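(* Let $\alpha(L),\alpha(H),\sigma(L),\sigma(H)$ be real numbers with $\alpha(H)>\alpha(L)>0$, $\sigma(L)>0$, $\sigma(H)>0$, and $\alpha(H)/\sigma(H)>\alpha(L)/\sigma(L)$. For each regime $s\in\{L,H\}$, the unconstrained problem of maximizing over $\theta\in\mathbb{R}$ the expected compound active return $$r_s(\theta)=\theta\,\alpha(s)-\tfrac12\,\theta^2\sigma(s)^2$$ has optimal active weight $\theta^*(s)=\alpha(s)/\sigma(s)^2$, the corresponding optimal unconstrained tracking error $TE^*(s)=|\theta^*(s)|\,\sigma(s)$ equals $\alpha(s)/\sigma(s)$, and $$TE^*(H)>TE^*(L).$$
   Context: A portfolio manager chooses an active weight $\theta\in\mathbb{R}$, the deviation of the portfolio from a benchmark. There are two regimes, a low-risk state $L$ and a high-risk state $H$. In regime $s$, $\alpha(s)$ is the expected active return per unit of active weight and $\sigma(s)$ is the volatility of the active return. The tracking error of active weight $\theta$ in regime $s$ is $|\theta|\,\sigma(s)$. "Unconstrained" means that no upper bound is imposed on the tracking error. The ratio $\alpha(s)/\sigma(s)$ is the information ratio in regime $s$. *)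

theory Defs
  imports Complex_Main
begin

datatype regime = L | H

definition compound_return :: "(regime \<Rightarrow> real) \<Rightarrow> (regime \<Rightarrow> real) \<Rightarrow> regime \<Rightarrow> real \<Rightarrow> real" where
  "compound_return \<alpha> \<sigma> s \<theta> = \<theta> * \<alpha> s - 1 / 2 * \<theta>\<^sup>2 * (\<sigma> s)\<^sup>2"

definition tracking_error :: "(regime \<Rightarrow> real) \<Rightarrow> regime \<Rightarrow> real \<Rightarrow> real" where
  "tracking_error \<sigma> s \<theta> = \<bar>\<theta>\<bar> * \<sigma> s"

(* Unconstrained: every real weight is feasible, so the feasibility predicate is constantly True. *)
definition is_optimal_weight :: "(regime \<Rightarrow> real) \<Rightarrow> (regime \<Rightarrow> real) \<Rightarrow> regime \<Rightarrow> real \<Rightarrow> bool" where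
  "is_optimal_weight \<alpha> \<sigma> s \<theta> \<longleftrightarrow> is_arg_max (compound_return \<alpha> \<sigma> s) (\<lambda>_. True) \<theta>"

(* A choice of maximizer; meaningful only where a maximizer exists, and canonical only where it
   is unique. *)
definition optimal_weight :: "(regime \<Rightarrow> real) \<Rightarrow> (regime \<Rightarrow> real) \<Rightarrow> regime \<Rightarrow> real" where
  "optimal_weight \<alpha> \<sigma> s = arg_max (compound_return \<alpha> \<sigma> s) (\<lambda>_. True)"

definition optimal_tracking_error :: "(regime \<Rightarrow> real) \<Rightarrow> (regime \<Rightarrow> real) \<Rightarrow> regime \<Rightarrow> real" where
  "optimal_tracking_error \<alpha> \<sigma> s = tracking_error \<sigma> s (optimal_weight \<alpha> \<sigma> s)"

end

theory Submission
  imports Defs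
begin

text \<open>Completing the square turns the return into a constant minus (\<sigma> s)^2/2 times the
  squared distance of \<theta> from \<alpha> s / (\<sigma> s)^2. For nonzero volatility this is a
  strictly concave parabola, so its vertex is the only maximizer
  (\<open>is_optimal_weight_iff\<close>). Multiplying the vertex by the volatility cancels one
  factor \<sigma> s and leaves the information ratio (\<open>optimal_tracking_error_eq\<close>), so
  the ranking of tracking errors is the assumed ranking of information ratios.\<close>

lemma compound_return_complete_square:
  assumes "\<sigma> s \<noteq> 0"
  shows "compound_return \<alpha> \<sigma> s \<theta> =
    (\<alpha> s)\<^sup>2 / (2 * (\<sigma> s)\<^sup>2) - (\<sigma> s)\<^sup>2 / 2 * (\<theta> - \<alpha> s / (\<sigma> s)\<^sup>2)\<^sup>2"
  using assms unfolding compound_return_def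
  by (simp add: field_simps power2_eq_square)

lemma is_optimal_weight_iff:
  assumes "\<sigma> s \<noteq> 0"
  shows "is_optimal_weight \<alpha> \<sigma> s \<theta> \<longleftrightarrow> \<theta> = \<alpha> s / (\<sigma> s)\<^sup>2"
proof
  assume "is_optimal_weight \<alpha> \<sigma> s \<theta>"
  \<comment> \<open>\<open>is_arg_max\<close> says that no point is strictly better; the vertex is
    the competitor to test, since the square vanishes there.\<close>
  then have "\<not> compound_return \<alpha> \<sigma> s \<theta> < compound_return \<alpha> \<sigma> s (\<alpha> s / (\<sigma> s)\<^sup>2)"
    by (simp add: is_optimal_weight_def is_arg_max_def)
  then have "(\<sigma> s)\<^sup>2 / 2 * (\<theta> - \<alpha> s / (\<sigma> s)\<^sup>2)\<^sup>2 \<le> 0"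
    by (simp add: compound_return_complete_square assms)
  then show "\<theta> = \<alpha> s / (\<sigma> s)\<^sup>2"
    using assms by (simp add: mult_le_0_iff)
next
  assume "\<theta> = \<alpha> s / (\<sigma> s)\<^sup>2"
  then show "is_optimal_weight \<alpha> \<sigma> s \<theta>"
    by (simp add: is_optimal_weight_def is_arg_max_def compound_return_complete_square assms not_less)
qed

text \<open>\<open>arg_max\<close> is a Hilbert choice; uniqueness of the maximizer pins down its
  value.\<close>

lemma optimal_weight_eq:
  assumes "\<sigma> s \<noteq> 0"
  shows "optimal_weight \<alpha> \<sigma> s = \<alpha> s / (\<sigma> s)\<^sup>2"
  using is_optimal_weight_iff[where \<alpha>=\<alpha> and \<sigma>=\<sigma> and s=s, OF assms]
  by (simp add: optimal_weight_def arg_max_def is_optimal_weight_def)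

text \<open>The sign condition on \<alpha> s removes the absolute value from the weight.\<close>

lemma optimal_tracking_error_eq:
  assumes "\<alpha> s \<ge> 0" and "\<sigma> s > 0"
  shows "optimal_tracking_error \<alpha> \<sigma> s = \<alpha> s / \<sigma> s"
  using assms
  by (simp add: optimal_tracking_error_def tracking_error_def optimal_weight_eq power2_eq_square)

theorem proposition1:
  fixes \<alpha> \<sigma> :: "regime \<Rightarrow> real"
  assumes "\<alpha> H > \<alpha> L" and "\<alpha> L > 0"
    and "\<sigma> L > 0" and "\<sigma> H > 0"
    and "\<alpha> H / \<sigma> H > \<alpha> L / \<sigma> L"
  shows "(\<forall>s. (\<forall>\<theta>. is_optimal_weight \<alpha> \<sigma> s \<theta> \<longleftrightarrow> \<theta> = \<alpha> s / (\<sigma> s)\<^sup>2)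
             \<and> optimal_weight \<alpha> \<sigma> s = \<alpha> s / (\<sigma> s)\<^sup>2
             \<and> optimal_tracking_error \<alpha> \<sigma> s = \<alpha> s / \<sigma> s)
         \<and> optimal_tracking_error \<alpha> \<sigma> H > optimal_tracking_error \<alpha> \<sigma> L"
proof -
  \<comment> \<open>Positivity of \<alpha> H comes from the chain \<alpha> H > \<alpha> L >
    0.\<close>
  have pos: "\<alpha> s > 0" "\<sigma> s > 0" for s
    using assms by (cases s; simp)+
  have nz: "\<sigma> s \<noteq> 0" for s
    using pos(2)[of s] by simp
  show ?thesis
    using assms(5) pos nz
    by (simp add: is_optimal_weight_iff optimal_weight_eq optimal_tracking_error_eq less_imp_le)
qed

end
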